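(* Let $M$ be a Puiseux monoid, and let $n = \gcd(\mathsf{n}(M^\bullet))$. Then the following statements hold. (1) $\widetilde{M} = \widehat{M} = \mathrm{gp}(M) \cap \mathbb{Q}_{\ge 0}$. (2) $\widetilde{M} = n \langle 1/d \mid d \in \mathsf{d}(M^\bullet) \rangle$.
   Context: A Puiseux monoid is an additive submonoid of $\mathbb{Q}_{\ge 0}$. Write $\mathbb{N} = \{1,2,3,\dots\}$. For a Puiseux monoid $M$: $M^\bullet := M \setminus \{0\}$; the difference group is $\mathrm{gp}(M) = \{x-y \mid x,y \in M\} \subseteq \mathbb{Q}$; the root closure is $\widetilde{M} := \{x \in \mathrm{gp}(M) \mid kx \in M \text{ for some } k \in \mathbb{N}\}$; the complete integral closure is $\widehat{M} := \{x \in \mathrm{gp}(M) \mid \text{there exists } c \in M \text{ such that } c + kx \in M \text{ for all } k \in \mathbb{N}\}$. For $q \in \mathbb{Q}\setminus\{0\}$, $\mathsf{n}(q) \in \mathbb{Z}$ and $\mathsf{d}(q) \in \mathbb{N}$ are the unique integers with $q = \mathsf{n}(q)/\mathsf{d}(q)$ and $\gcd(\mathsf{n}(q),\mathsf{d}(q)) = 1$; for $Q \subseteq \mathbb{Q}\setminus\{0\}$, $\mathsf{n}(Q) = \{\mathsf{n}(q) \mid q \in Q\}$ and $\mathsf{d}(Q) = \{\mathsf{d}(q) \mid q \in Q\}$. For a set $S$, $\langle S \rangle$ denotes the additive monoid generated by $S$, and $n\langle S\rangle = \{ns \mid s \in \langle S \rangle\}$. *)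

theory Defs
  imports Complex_Main
begin

definition puiseux_monoid :: "rat set \<Rightarrow> bool" where
  "puiseux_monoid M \<longleftrightarrow>
     M \<subseteq> {q. q \<ge> 0} \<and> 0 \<in> M \<and> (\<forall>x\<in>M. \<forall>y\<in>M. x + y \<in> M)"

definition gp :: "rat set \<Rightarrow> rat set" where
  "gp M = {x - y | x y. x \<in> M \<and> y \<in> M}"

definition root_closure :: "rat set \<Rightarrow> rat set" where
  "root_closure M = {x \<in> gp M. \<exists>k::nat. k > 0 \<and> of_nat k * x \<in> M}"

definition complete_integral_closure :: "rat set \<Rightarrow> rat set" where
  "complete_integral_closure M =
     {x \<in> gp M. \<exists>c\<in>M. \<forall>k::nat. k > 0 \<longrightarrow> c + of_nat k * x \<in> M}"

text \<open>
  \<open>quotient_of q\<close> is the pair of coprime integers with quotient \<open>q\<close> and positive second component.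
\<close>

definition numer :: "rat \<Rightarrow> int" where
  "numer q = fst (quotient_of q)"

definition denom :: "rat \<Rightarrow> int" where
  "denom q = snd (quotient_of q)"

inductive_set generated_monoid :: "'a::comm_monoid_add set \<Rightarrow> 'a set" for S where
  zero: "0 \<in> generated_monoid S"
| base: "s \<in> S \<Longrightarrow> s \<in> generated_monoid S"
| add: "x \<in> generated_monoid S \<Longrightarrow> y \<in> generated_monoid S \<Longrightarrow> x + y \<in> generated_monoid S"

end

theory Submission
  imports Defs
begin

text \<open>
  If \<open>x = a - b \<ge> 0\<close> with \<open>a, b \<in> M\<close>, then \<open>N x \<in> M\<close> for some \<open>N > 0\<close>, and \<open>c = N b\<close>
  witnesses that \<open>x\<close> is almost integral: for \<open>k = q N + r\<close> with \<open>r < N\<close> we have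
  \<open>c + k x = q (N x) + (N - r) b + r a\<close>.

  For part (2), write \<open>x = a - b\<close> with \<open>a, b \<in> M\<close> and let \<open>d\<close> be the denominator of \<open>b\<close>.
  Then \<open>x + d b = a + (d - 1) b\<close> is in \<open>M\<close> and \<open>d b\<close> is an integer, so \<open>x\<close> has the
  denominator of an element of \<open>M\<close>. Since \<open>n\<close> is coprime to all denominators of nonzero elements
  of \<open>M\<close>, it divides the numerator of \<open>x\<close>; hence every nonnegative \<open>x \<in> gp M\<close> lies in
  \<open>n \<langle>1/d\<rangle>\<close>. Conversely, \<open>gp M\<close> contains all numerators, hence \<open>n\<close>; if \<open>a/d \<in> M\<close> is in
  lowest terms and \<open>u a + v d = 1\<close>, then \<open>n/d = n u (a/d) + v n\<close> is in \<open>gp M\<close>.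
\<close>

section \<open>Lowest terms, greatest common divisors and generated monoids\<close>

lemma rat_eq_numer_denom: "q = of_int (numer q) / of_int (denom q)"
  by (simp add: numer_def denom_def quotient_of_div[of q])

lemma denom_pos: "denom q > 0"
  by (simp add: denom_def quotient_of_denom_pos')

lemma coprime_numer_denom: "coprime (numer q) (denom q)"
  by (simp add: numer_def denom_def quotient_of_coprime[of q])

lemma denom_mult: "of_int (denom q) * q = of_int (numer q)"
  using rat_eq_numer_denom[of q] denom_pos[of q] by (simp add: field_simps)

lemma numer_pos: "q > 0 \<Longrightarrow> numer q > 0"
  using denom_mult[of q] denom_pos[of q] by (metis mult_pos_pos of_int_0_less_iff)

lemma denom_eqI:
  assumes "q = of_int a / of_int b" "b > 0" "coprime a b"
  shows "denom q = b"
  using assms by (simp add: denom_def Fract_of_int_quotient[symmetric] quotient_of_Fract)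

lemma denom_add_of_int: "denom (q + of_int k) = denom q"
proof (rule denom_eqI)
  show "q + of_int k = of_int (numer q + k * denom q) / of_int (denom q)"
    using rat_eq_numer_denom[of q] denom_pos[of q] by (simp add: add_divide_distrib)
  show "coprime (numer q + k * denom q) (denom q)"
    using coprime_numer_denom[of q]
    by (metis add.commute coprime_iff_gcd_eq_1 gcd.commute gcd_add_mult)
qed (rule denom_pos)

text \<open>The least positive element \<open>g\<close> of \<open>I\<close> divides every element of
  \<open>S\<close>, hence also \<open>Gcd S\<close>, which is then a multiple of \<open>g\<close>.
  The argument covers infinite \<open>S\<close>, which is the case needed for sets of
  numerators.\<close>

lemma Gcd_mem_subgroup:
  fixes S I :: "int set"
  assumes "S \<subseteq> I" and zero: "0 \<in> I"
    and diff: "\<And>x y. x \<in> I \<Longrightarrow> y \<in> I \<Longrightarrow> x - y \<in> I"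
    and mult: "\<And>c x. x \<in> I \<Longrightarrow> c * x \<in> I"
  shows "Gcd S \<in> I"
proof (cases "S \<subseteq> {0}")
  case True
  then show ?thesis using zero by (metis Gcd_0_iff)
next
  case False
  then obtain s where s: "s \<in> S" "s \<noteq> 0" by blast
  let ?P = "\<lambda>m::nat. m > 0 \<and> int m \<in> I"
  have "\<bar>s\<bar> \<in> I" using s assms(1) mult[of s "-1"] by (auto simp: abs_if)
  then have "?P (nat \<bar>s\<bar>)" using s by simp
  then have g: "?P (LEAST m. ?P m)" by (rule LeastI)
  define g where "g = (LEAST m. ?P m)"
  have "int g dvd x" if "x \<in> S" for x
  proof -
    have "x mod int g = x - (x div int g) * int g" by (simp add: minus_div_mult_eq_mod)
    then have "x mod int g \<in> I" using diff mult g that assms(1) unfolding g_def by auto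
    moreover have "0 \<le> x mod int g" "x mod int g < int g" using g unfolding g_def by simp_all
    \<comment> \<open>A positive remainder would be an element of \<open>I\<close> below the least
      positive one.\<close>
    ultimately have "\<not> nat (x mod int g) > 0"
      using not_less_Least[of "nat (x mod int g)" ?P] unfolding g_def by auto
    then have "x mod int g = 0" using \<open>0 \<le> x mod int g\<close> by linarith
    then show ?thesis by auto
  qed
  then have "int g dvd Gcd S" by (rule Gcd_greatest)
  then obtain c where "Gcd S = int g * c" by (rule dvdE)
  then show ?thesis using mult[of "int g" c] g unfolding g_def by (simp add: mult.commute)
qed

lemma generated_monoid_of_nat_mult:
  "s \<in> generated_monoid S \<Longrightarrow> of_nat k * (s :: rat) \<in> generated_monoid S"
  by (induction k) (auto intro: generated_monoid.intros simp: distrib_right)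

section \<open>Arithmetic in a Puiseux monoid and its difference group\<close>

context
  fixes M :: "rat set"
  assumes M: "puiseux_monoid M"
begin

lemma zero_mem: "0 \<in> M" and add_mem: "x \<in> M \<Longrightarrow> y \<in> M \<Longrightarrow> x + y \<in> M"
  and nonneg: "x \<in> M \<Longrightarrow> x \<ge> 0"
  using M by (auto simp: puiseux_monoid_def)

lemma of_nat_mult_mem: "x \<in> M \<Longrightarrow> of_nat k * x \<in> M"
  by (induction k) (auto simp: zero_mem add_mem distrib_right)

lemma of_int_mult_mem: "x \<in> M \<Longrightarrow> k \<ge> 0 \<Longrightarrow> of_int k * x \<in> M"
  using of_nat_mult_mem[of x "nat k"] by simp

lemma mem_gp: "x \<in> M \<Longrightarrow> x \<in> gp M"
  unfolding gp_def using zero_mem by force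

lemma gp_uminus: "x \<in> gp M \<Longrightarrow> - x \<in> gp M"
  unfolding gp_def by force

lemma gp_add:
  assumes "x \<in> gp M" "y \<in> gp M"
  shows "x + y \<in> gp M"
proof -
  from assms obtain a b c d where *: "a \<in> M" "b \<in> M" "c \<in> M" "d \<in> M" "x = a - b" "y = c - d"
    unfolding gp_def by blast
  then have "x + y = (a + c) - (b + d)" by simp
  then show ?thesis unfolding gp_def using * add_mem by blast
qed

lemma gp_of_nat_mult: "x \<in> gp M \<Longrightarrow> of_nat k * x \<in> gp M"
  by (induction k) (auto simp: mem_gp zero_mem gp_add distrib_right)

lemma gp_of_int_mult: "x \<in> gp M \<Longrightarrow> of_int k * x \<in> gp M"
  using gp_of_nat_mult[of x "nat k"] gp_uminus[OF gp_of_nat_mult[of x "nat (-k)"]]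
  by (cases "k \<ge> 0") auto

lemma of_int_numer_mem_gp: "x \<in> M \<Longrightarrow> of_int (numer x) \<in> gp M"
  using gp_of_int_mult[OF mem_gp, of x "denom x"] by (simp add: denom_mult)

section \<open>The root closure and the complete integral closure\<close>

lemma multiple_mem:
  assumes "x \<in> gp M" "x \<ge> 0"
  shows "\<exists>k::nat. k > 0 \<and> of_nat k * x \<in> M"
proof (cases "x = 0")
  case True
  then show ?thesis using zero_mem by (intro exI[of _ 1]) simp
next
  case False
  then have x: "x > 0" using assms by simp
  \<comment> \<open>If \<open>x = a - b\<close> is positive, then \<open>a > b \<ge> 0\<close>, so
    \<open>m = a\<close> will do.\<close>
  from assms obtain m where m: "m \<in> M" "m > 0"
    using x nonneg unfolding gp_def
    by (smt (verit) mem_Collect_eq diff_gt_0_iff_gt order_le_less_trans)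
  \<comment> \<open>Two positive rationals have a common positive multiple; for \<open>x\<close> and
    \<open>m\<close> it is the product of their numerators.\<close>
  have "of_int (numer m * denom x) * x = of_int (numer m) * of_int (numer x)"
    by (simp add: denom_mult mult.assoc)
  also have "\<dots> = of_int (numer x * denom m) * m"
    by (simp add: denom_mult mult.assoc)
  also have "\<dots> \<in> M"
    using m x numer_pos[of x] denom_pos[of m] by (intro of_int_mult_mem) auto
  finally have "of_nat (nat (numer m * denom x)) * x \<in> M"
    using numer_pos[of m] m denom_pos[of x] by simp
  then show ?thesis
    using numer_pos[of m] m denom_pos[of x] by (intro exI[of _ "nat (numer m * denom x)"]) simp
qed

lemma root_closure_eq: "root_closure M = gp M \<inter> {q. q \<ge> 0}"
proof
  show "root_closure M \<subseteq> gp M \<inter> {q. q \<ge> 0}"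
    unfolding root_closure_def using nonneg by (force simp: zero_le_mult_iff)
  show "gp M \<inter> {q. q \<ge> 0} \<subseteq> root_closure M"
    unfolding root_closure_def using multiple_mem by blast
qed

lemma complete_integral_closure_eq: "complete_integral_closure M = gp M \<inter> {q. q \<ge> 0}"
proof (intro equalityI subsetI)
  fix x assume "x \<in> complete_integral_closure M"
  then obtain c where c: "x \<in> gp M" "c \<in> M" "\<And>k::nat. k > 0 \<Longrightarrow> c + of_nat k * x \<in> M"
    unfolding complete_integral_closure_def by blast
  have "x \<ge> 0"
  proof (rule ccontr)
    assume "\<not> x \<ge> 0"
    \<comment> \<open>By the Archimedean property some \<open>c + k * x\<close> is negative, while
      \<open>M\<close> has no negative elements.\<close>
    then obtain k :: nat where k: "c < of_nat k * (- x)"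
      using ex_less_of_nat_mult[of "- x" c] by auto
    moreover have "k > 0" using k nonneg[OF c(2)] by (cases k) auto
    ultimately show False using nonneg[OF c(3)[of k]] by simp
  qed
  then show "x \<in> gp M \<inter> {q. q \<ge> 0}" using c by simp
next
  fix x assume "x \<in> gp M \<inter> {q. q \<ge> 0}"
  then have x: "x \<in> gp M" "x \<ge> 0" by simp_all
  then obtain N :: nat where N: "N > 0" "of_nat N * x \<in> M" using multiple_mem by blast
  obtain a b where ab: "a \<in> M" "b \<in> M" "x = a - b" using x unfolding gp_def by blast
  have "of_nat N * b + of_nat k * x \<in> M" for k :: nat
  proof -
    define q r where "q = k div N" and "r = k mod N"
    \<comment> \<open>This bound makes the natural number \<open>N - r\<close> an honest difference
      when it is cast to \<open>rat\<close>.\<close>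
    have r: "r \<le> N" using N by (simp add: r_def less_imp_le)
    have k: "of_nat k = (of_nat q * of_nat N + of_nat r :: rat)"
      unfolding q_def r_def by (metis div_mult_mod_eq of_nat_add of_nat_mult)
    have "of_nat N * b + of_nat k * x
        = of_nat q * (of_nat N * x) + (of_nat (N - r) * b + of_nat r * a)"
      unfolding k using r by (simp add: of_nat_diff ab(3) algebra_simps)
    also have "\<dots> \<in> M" using N(2) ab(1,2)
      by (intro add_mem of_nat_mult_mem[of b] of_nat_mult_mem[of a] of_nat_mult_mem[of "of_nat N * x"])
    finally show ?thesis .
  qed
  then show "x \<in> complete_integral_closure M"
    unfolding complete_integral_closure_def using x(1) of_nat_mult_mem[OF ab(2)] by blast
qed

section \<open>The difference group in terms of numerators and denominators\<close>

lemma denom_gp: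
  assumes "x \<in> gp M" "x > 0"
  shows "denom x \<in> denom ` (M - {0})"
proof -
  obtain a b where ab: "a \<in> M" "b \<in> M" "x = a - b" using assms unfolding gp_def by blast
  have "x + of_int (numer b) = a + of_int (denom b - 1) * b"
    by (simp add: ab(3) denom_mult[symmetric] algebra_simps)
  also have "\<dots> \<in> M" using ab denom_pos[of b] by (intro add_mem of_int_mult_mem) auto
  finally have "x + of_int (numer b) \<in> M" .
  \<comment> \<open>Positivity places the shifted element in \<open>M - {0}\<close>.\<close>
  moreover have "x + of_int (numer b) > 0"
    using assms(2) nonneg[OF ab(2)] denom_mult[of b] denom_pos[of b]
    by (metis add_pos_nonneg less_imp_le mult_nonneg_nonneg of_int_0_le_iff)
  ultimately show ?thesis
    by (intro image_eqI[of _ _ "x + of_int (numer b)"]) (auto simp: denom_add_of_int)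
qed

lemma Gcd_numer_dvd_numer_gp:
  assumes "x \<in> gp M"
  shows "Gcd (numer ` (M - {0})) dvd numer x" (is "?n dvd _")
proof -
  obtain a b where ab: "a \<in> M" "b \<in> M" "x = a - b" using assms unfolding gp_def by blast
  have zero: "numer 0 = 0" "denom 0 = 1" by (simp_all add: numer_def denom_def)
  have dvd: "?n dvd numer y" if "y \<in> M" for y
  proof (cases "y = 0")
    case True
    then show ?thesis by (simp only: zero dvd_0_right)
  next
    case False
    then show ?thesis using that by (intro Gcd_dvd imageI) blast
  qed
  have cop: "coprime ?n (denom y)" if "y \<in> M" for y
    using coprime_divisors[OF dvd[OF that] dvd_refl coprime_numer_denom] .
  \<comment> \<open>Clearing denominators in \<open>x = a - b\<close> gives an integer identity
    whose right-hand side is divisible by the gcd.\<close>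
  have "(of_int (numer x * (denom a * denom b)) :: rat)
      = of_int (denom x) * x * (of_int (denom a) * of_int (denom b))"
    by (simp add: denom_mult)
  also have "\<dots> = of_int (denom x) * (of_int (denom a) * a * of_int (denom b)
      - of_int (denom b) * b * of_int (denom a))"
    by (simp add: ab(3) algebra_simps)
  also have "\<dots> = of_int (denom x * (numer a * denom b - numer b * denom a))"
    by (simp add: denom_mult)
  finally have "numer x * (denom a * denom b) = denom x * (numer a * denom b - numer b * denom a)"
    by (simp only: of_int_eq_iff)
  then have "?n dvd numer x * (denom a * denom b)" using dvd[OF ab(1)] dvd[OF ab(2)] by simp
  moreover have "coprime ?n (denom a * denom b)" using cop ab by simp
  ultimately show ?thesis by (simp add: coprime_dvd_mult_left_iff)
qed

text \<open>The integers in \<open>gp M\<close> form a subgroup containing every numerator, since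
  \<open>numer x\<close> is the multiple \<open>denom x * x\<close>.\<close>

lemma Gcd_numer_mem_gp: "of_int (Gcd (numer ` (M - {0}))) \<in> gp M"
proof -
  have "Gcd (numer ` (M - {0})) \<in> {k. of_int k \<in> gp M}"
  proof (rule Gcd_mem_subgroup)
    show "x - y \<in> {k. of_int k \<in> gp M}"
      if "x \<in> {k. of_int k \<in> gp M}" "y \<in> {k. of_int k \<in> gp M}" for x y
      using that gp_add[OF _ gp_uminus, of "of_int x" "of_int y"] by simp
  qed (auto simp: of_int_numer_mem_gp mem_gp zero_mem gp_of_int_mult)
  then show ?thesis by simp
qed

lemma Gcd_numer_div_denom_mem_gp:
  assumes "x \<in> M"
  shows "of_int (Gcd (numer ` (M - {0}))) * (1 / of_int (denom x)) \<in> gp M" (is "of_int ?n * _ \<in> _")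
proof -
  obtain u v where uv: "u * numer x + v * denom x = 1"
    using bezout_int[of "numer x" "denom x"] coprime_numer_denom[of x] by auto
  have "(of_int ?n * (1 / of_int (denom x)) :: rat)
      = of_int ?n * (of_int (u * numer x + v * denom x) / of_int (denom x))"
    by (simp add: uv)
  also have "\<dots> = of_int (?n * u) * (of_int (numer x) / of_int (denom x)) + of_int v * of_int ?n"
    using denom_pos[of x] by (simp add: field_simps)
  also have "\<dots> = of_int (?n * u) * x + of_int v * of_int ?n"
    using rat_eq_numer_denom[of x] by simp
  also have "\<dots> \<in> gp M"
    using assms by (intro gp_add gp_of_int_mult mem_gp Gcd_numer_mem_gp)
  finally show ?thesis .
qed

text \<open>For \<open>M = {0}\<close> the gcd is 0 and there are no generators, so both sides are
  \<open>{0}\<close>.\<close>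

lemma nonneg_gp_eq_generated_monoid:
  defines "n \<equiv> Gcd (numer ` (M - {0}))"
  shows "gp M \<inter> {q. q \<ge> 0} =
    (\<lambda>s. of_int n * s) ` generated_monoid {1 / of_int d | d. d \<in> denom ` (M - {0})}"
    (is "_ = _ ` generated_monoid ?S")
proof (intro equalityI subsetI)
  fix x assume "x \<in> gp M \<inter> {q. q \<ge> 0}"
  then have x: "x \<in> gp M" "x \<ge> 0" by simp_all
  show "x \<in> (\<lambda>s. of_int n * s) ` generated_monoid ?S"
  proof (cases "x = 0")
    case True
    then show ?thesis by (intro image_eqI[of _ _ 0]) (auto intro: generated_monoid.zero)
  next
    case False
    then have pos: "x > 0" using x by simp
    obtain c where c: "numer x = n * c"
      using Gcd_numer_dvd_numer_gp[OF x(1)] unfolding n_def by blast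
    \<comment> \<open>The sign of \<open>n\<close> forces \<open>c > 0\<close>, so \<open>x\<close>
      is \<open>n\<close> times a sum of \<open>c\<close> copies of one generator.\<close>
    have "n \<ge> 0" unfolding n_def by simp
    then have "c > 0" using numer_pos[OF pos] c by (simp add: zero_less_mult_iff)
    have "1 / of_int (denom x) \<in> ?S" using denom_gp[OF x(1) pos] by blast
    then have "of_nat (nat c) * (1 / of_int (denom x)) \<in> generated_monoid ?S"
      by (intro generated_monoid_of_nat_mult generated_monoid.base)
    moreover have "x = of_int n * (of_nat (nat c) * (1 / of_int (denom x)))"
      using rat_eq_numer_denom[of x] \<open>c > 0\<close> by (simp add: c)
    ultimately show ?thesis by (rule image_eqI[rotated])
  qed
next
  fix x assume "x \<in> (\<lambda>s. of_int n * s) ` generated_monoid ?S"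
  then obtain s where s: "s \<in> generated_monoid ?S" and x: "x = of_int n * s" by blast
  \<comment> \<open>The factor \<open>n\<close> stays inside the induction: \<open>1/d\<close>
    itself need not lie in \<open>gp M\<close>, but \<open>n/d\<close> does.\<close>
  from s have "of_int n * s \<in> gp M \<and> of_int n * s \<ge> 0"
  proof induction
    case zero
    then show ?case using mem_gp[OF zero_mem] by simp
  next
    case (base s)
    then obtain y where "y \<in> M" "s = 1 / of_int (denom y)" by blast
    then show ?case
      using Gcd_numer_div_denom_mem_gp[of y] denom_pos[of y] unfolding n_def by simp
  next
    case (add s t)
    then show ?case using gp_add by (simp add: distrib_left)
  qed
  then show "x \<in> gp M \<inter> {q. q \<ge> 0}" using x by simp
qed

end

theorem proposition3p5:
  fixes M :: "rat set" and n :: int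
  assumes "puiseux_monoid M"
    and "n = Gcd (numer ` (M - {0}))"
  shows "(root_closure M = complete_integral_closure M \<and>
          complete_integral_closure M = gp M \<inter> {q. q \<ge> 0}) \<and>
         root_closure M =
           (\<lambda>s. of_int n * s) ` generated_monoid {1 / of_int d | d. d \<in> denom ` (M - {0})}"
  using assms root_closure_eq complete_integral_closure_eq nonneg_gp_eq_generated_monoid
  by simp

end
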